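(* Let $V$ be a complete order smooth $\infty$-normed space and let $\tilde V$ be the order unit space obtained by adjoining an order unit to $V$. Then $V$ is an $M$-ideal in $\tilde V$ if and only if $V$ is an approximate order unit space.
   Context: Let $(V,V^+)$ be a real ordered vector space whose positive cone $V^+$ is proper ($V^+\cap -V^+=\{0\}$) and generating ($V=V^+-V^+$), with a norm in which $V^+$ is closed. $V$ is an order smooth $\infty$-normed space if: $(O.\infty.1)$ $u\le v\le w$ implies $\|v\|\le\max(\|u\|,\|w\|)$; $(O.\infty.2)$ for $v\in V$ and $\epsilon>0$ there are $v_1,v_2\in V^+$ with $v=v_1-v_2$ and $\max(\|v_1\|,\|v_2\|)\le\|v\|+\epsilon$. An approximate order unit for $V$ is an increasing net $\{e_\lambda\}\subseteq V^+$ such that for each $v\in V$ there is $r>0$ with $re_\lambda\pm v\in V^+$ for some $\lambda$. It determines the seminorm $\|v\|_a=\inf\{r>0: re_\lambda\pm v\in V^+\text{ for some }\lambda\}$. $(V,\{e_\lambda\})$ is an approximate order unit space if $\|\cdot\|_a$ is a norm in which $V^+$ is closed; a real ordered vector space $(V,V^+)$ with proper and generating cone $V^+$, equipped with a norm $\|\cdot\|$ in which $V^+$ is closed, is an approximate order unit space if its norm $\|\cdot\|$ equals $\|\cdot\|_a$ for some approximate order unit $\{e_\lambda\}$ for $V$. If $e_\lambda=e$ for all $\lambda$, $e$ is called an order unit, and (when $V^+$ is Archimedean: $re+v\ge0$ for all $r>0$ implies $v\in V^+$) $(V,e)$ with this norm is an order unit space. Adjoining an order unit: $\tilde V=V\oplus\mathbb{R}$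 with $\tilde V^+=\{(v,\alpha): l_V(v)\le\alpha\}$, where $l_V(v)=\inf\{\|u\|: u,\ u+v\in V^+\}$. Then $(\tilde V,(0,1))$ is an order unit space, normed by its order unit norm, and $v\mapsto(v,0)$ is an isometric order isomorphic embedding by which $V$ is identified with a subspace of $\tilde V$. A closed subspace $X$ of a real Banach space $E$ is an $L$-summand if there is a closed subspace $X'$ with $E=X\oplus_1X'$ (direct sum with $\|x+x'\|=\|x\|+\|x'\|$). A closed subspace $W$ of a real Banach space $E$ is an $M$-ideal if its annihilator $W^\perp$ is an $L$-summand in $E^*$. *)

theory Defs
  imports "HOL-Analysis.Analysis"
begin

section \<open>Order smooth $\infty$-normed spaces\<close>

text \<open>
  The positive cone of a type of class \<open>ordered_real_vector\<close> is \<open>{v. 0 \<le> v}\<close>; it is proper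
  because \<open>\<le>\<close> is antisymmetric, and it determines \<open>\<le>\<close> since \<open>u \<le> v \<longleftrightarrow> 0 \<le> v - u\<close>.
\<close>

abbreviation positive_cone :: "'a::ordered_real_vector set"
  where "positive_cone \<equiv> {v. 0 \<le> v}"

class order_smooth_inf_normed = ordered_real_vector + real_normed_vector +
  assumes cone_generating: "\<exists>v1 v2. 0 \<le> v1 \<and> 0 \<le> v2 \<and> v = v1 - v2"
    and cone_closed: "closed {v. 0 \<le> v}"
    and order_smooth_1: "u \<le> v \<Longrightarrow> v \<le> w \<Longrightarrow> norm v \<le> max (norm u) (norm w)"
    and order_smooth_2:
      "0 < \<epsilon> \<Longrightarrow> \<exists>v1 v2. 0 \<le> v1 \<and> 0 \<le> v2 \<and> v = v1 - v2 \<and> max (norm v1) (norm v2) \<le> norm v + \<epsilon>"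


section \<open>Approximate order units\<close>

definition directed_set :: "'i set \<Rightarrow> ('i \<Rightarrow> 'i \<Rightarrow> bool) \<Rightarrow> bool" where
  "directed_set I r \<longleftrightarrow>
     I \<noteq> {} \<and>
     (\<forall>i\<in>I. r i i) \<and>
     (\<forall>i\<in>I. \<forall>j\<in>I. \<forall>k\<in>I. r i j \<longrightarrow> r j k \<longrightarrow> r i k) \<and>
     (\<forall>i\<in>I. \<forall>j\<in>I. \<exists>k\<in>I. r i k \<and> r j k)"

definition approx_order_unit ::
  "'i set \<Rightarrow> ('i \<Rightarrow> 'i \<Rightarrow> bool) \<Rightarrow> ('i \<Rightarrow> 'a::ordered_real_vector) \<Rightarrow> bool" where
  "approx_order_unit I r e \<longleftrightarrow>
     directed_set I r \<and>
     (\<forall>i\<in>I. 0 \<le> e i) \<and>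
     (\<forall>i\<in>I. \<forall>j\<in>I. r i j \<longrightarrow> e i \<le> e j) \<and>
     (\<forall>v. \<exists>t>0. \<exists>i\<in>I. 0 \<le> t *\<^sub>R e i + v \<and> 0 \<le> t *\<^sub>R e i - v)"

definition approx_order_unit_seminorm ::
  "'i set \<Rightarrow> ('i \<Rightarrow> 'a::ordered_real_vector) \<Rightarrow> 'a \<Rightarrow> real" where
  "approx_order_unit_seminorm I e v =
     Inf {t. 0 < t \<and> (\<exists>i\<in>I. 0 \<le> t *\<^sub>R e i + v \<and> 0 \<le> t *\<^sub>R e i - v)}"

text \<open>
  The nets range over index sets inside the space itself. This is no restriction on the directed
  sets considered, see \<open>approx_order_unit_spaceI\<close> below.
\<close>

definition approx_order_unit_space ::
  "'a::{ordered_real_vector, real_normed_vector} itself \<Rightarrow> bool" where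
  "approx_order_unit_space _ \<longleftrightarrow>
     (\<forall>v::'a. \<exists>v1 v2. 0 \<le> v1 \<and> 0 \<le> v2 \<and> v = v1 - v2) \<and>
     closed (positive_cone :: 'a set) \<and>
     (\<exists>(I :: 'a set) r (e :: 'a \<Rightarrow> 'a). approx_order_unit I r e \<and>
        (\<forall>v. norm v = approx_order_unit_seminorm I e v))"

lemma approx_order_unit_spaceI:
  fixes e :: "'i \<Rightarrow> 'a::order_smooth_inf_normed"
  assumes e: "approx_order_unit I r e"
    and n: "\<And>v. norm v = approx_order_unit_seminorm I e v"
  shows "approx_order_unit_space TYPE('a)"
proof -
  have dir: "directed_set I r" and mono: "\<And>i j. i \<in> I \<Longrightarrow> j \<in> I \<Longrightarrow> r i j \<Longrightarrow> e i \<le> e j"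
    using e unfolding approx_order_unit_def by blast+
  have "\<exists>k\<in>e ` I. e i \<le> k \<and> e j \<le> k" if "i \<in> I" "j \<in> I" for i j
    using dir that mono unfolding directed_set_def by blast
  moreover have "I \<noteq> {}" using dir by (simp add: directed_set_def)
  ultimately have "directed_set (e ` I) (\<le>)"
    unfolding directed_set_def by (simp add: ball_simps) (meson order_trans)
  with e have 1: "approx_order_unit (e ` I) (\<le>) (\<lambda>x. x)"
    unfolding approx_order_unit_def by (simp add: bex_simps ball_simps)
  have 2: "approx_order_unit_seminorm (e ` I) (\<lambda>x. x) v = approx_order_unit_seminorm I e v" for v
    unfolding approx_order_unit_seminorm_def by simp
  show ?thesis
    unfolding approx_order_unit_space_def
    using 1 by (intro conjI exI[of _ "e ` I"] exI[of _ "(\<le>)"] exI[of _ "\<lambda>x. x"])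
      (simp_all only: 2 n cone_generating cone_closed simp_thms)
qed

text \<open>An order unit is a constant approximate order unit.\<close>

definition order_unit :: "'a::ordered_real_vector \<Rightarrow> bool" where
  "order_unit e \<longleftrightarrow> approx_order_unit UNIV (=) (\<lambda>_::unit. e)"

definition order_unit_norm :: "'a::ordered_real_vector \<Rightarrow> 'a \<Rightarrow> real" where
  "order_unit_norm e = approx_order_unit_seminorm UNIV (\<lambda>_::unit. e)"

lemma order_unit_norm_eq:
  "order_unit_norm e v = Inf {t. 0 < t \<and> 0 \<le> t *\<^sub>R e + v \<and> 0 \<le> t *\<^sub>R e - v}"
  by (simp add: order_unit_norm_def approx_order_unit_seminorm_def)


section \<open>The functional defining the cone of the unitization\<close>

definition lfun :: "'a::{ordered_real_vector, real_normed_vector} \<Rightarrow> real" where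
  "lfun v = Inf {norm u | u. 0 \<le> u \<and> 0 \<le> u + v}"

context
  fixes type_dummy :: "'a::order_smooth_inf_normed itself"
begin

lemma lfun_witness: "\<exists>u. 0 \<le> u \<and> 0 \<le> u + v" for v :: 'a
proof -
  obtain v1 v2 where "0 \<le> v1" "0 \<le> v2" "v = v1 - v2" using cone_generating[of v] by blast
  then show ?thesis by (intro exI[of _ v2]) auto
qed

lemma lfun_le: "0 \<le> u \<Longrightarrow> 0 \<le> u + v \<Longrightarrow> lfun v \<le> norm u" for u v :: 'a
  unfolding lfun_def by (rule cInf_lower) (auto intro: bdd_belowI[of _ 0])

lemma lfun_greatest: "(\<And>u. 0 \<le> u \<Longrightarrow> 0 \<le> u + v \<Longrightarrow> c \<le> norm u) \<Longrightarrow> c \<le> lfun v" for v :: 'a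
  unfolding lfun_def by (rule cInf_greatest) (use lfun_witness in auto)

lemma lfun_lessE:
  fixes v :: 'a
  assumes "lfun v < c"
  obtains u where "0 \<le> u" "0 \<le> u + v" "norm u < c"
  using assms lfun_greatest[of v c] by (metis not_le)

lemma lfun_nonneg: "0 \<le> lfun v" for v :: 'a
  by (rule lfun_greatest) simp

lemma lfun_add: "lfun (v + w) \<le> lfun v + lfun w" for v w :: 'a
proof (rule field_le_epsilon)
  fix d :: real assume "0 < d"
  then have "lfun v < lfun v + d / 2" "lfun w < lfun w + d / 2" by auto
  then obtain a b where a: "0 \<le> a" "0 \<le> a + v" "norm a < lfun v + d / 2"
    and b: "0 \<le> b" "0 \<le> b + w" "norm b < lfun w + d / 2" by (meson lfun_lessE)
  have "0 \<le> (a + v) + (b + w)" by (rule add_nonneg_nonneg[OF a(2) b(2)])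
  then have "0 \<le> (a + b) + (v + w)" by (simp add: algebra_simps)
  then have "lfun (v + w) \<le> norm (a + b)" using a b by (intro lfun_le) auto
  also have "\<dots> \<le> norm a + norm b" by (rule norm_triangle_ineq)
  finally show "lfun (v + w) \<le> lfun v + lfun w + d" using a b by linarith
qed

lemma lfun_scaleR_le: "0 < c \<Longrightarrow> lfun (c *\<^sub>R v) \<le> c * lfun v" for v :: 'a
proof -
  assume c: "0 < c"
  have "lfun (c *\<^sub>R v) / c \<le> lfun v"
  proof (rule lfun_greatest)
    fix u :: 'a assume u: "0 \<le> u" "0 \<le> u + v"
    have "0 \<le> c *\<^sub>R (u + v)" using u c by (intro scaleR_nonneg_nonneg) auto
    then have "lfun (c *\<^sub>R v) \<le> norm (c *\<^sub>R u)"
      using u c by (intro lfun_le) (auto simp: scaleR_add_right intro: scaleR_nonneg_nonneg)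
    then show "lfun (c *\<^sub>R v) / c \<le> norm u" using c by (simp add: field_simps)
  qed
  then show ?thesis using c by (simp add: field_simps)
qed

lemma lfun_nonpos_iff: "lfun v \<le> 0 \<longleftrightarrow> 0 \<le> v" for v :: 'a
proof
  assume "0 \<le> v"
  then show "lfun v \<le> 0" using lfun_le[of 0 v] by simp
next
  assume l: "lfun v \<le> 0"
  show "0 \<le> v"
  proof (rule ccontr)
    assume "\<not> 0 \<le> v"
    then have "v \<in> - {v. 0 \<le> v}" by simp
    moreover have "open (- {v::'a. 0 \<le> v})" by (rule open_Compl[OF cone_closed])
    ultimately have "\<exists>d>0. \<forall>w. dist w v < d \<longrightarrow> w \<in> - {v. 0 \<le> v}"
      by (simp only: open_dist)
    then obtain d where d: "0 < d" "\<And>w. dist w v < d \<Longrightarrow> \<not> 0 \<le> w"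
      by auto
    obtain u where "0 \<le> u + v" "norm u < d" using lfun_lessE[OF le_less_trans[OF l d(1)]] by metis
    then show False using d(2)[of "u + v"] by (simp add: dist_norm)
  qed
qed

lemma lfun_zero [simp]: "lfun (0::'a) = 0"
  using lfun_nonpos_iff[of 0] lfun_nonneg[of 0] by simp

lemma lfun_scaleR: "0 \<le> c \<Longrightarrow> lfun (c *\<^sub>R v) = c * lfun v" for v :: 'a
proof (cases "c = 0")
  case False
  assume "0 \<le> c"
  with False have c: "0 < c" by simp
  have "c * lfun v = c * lfun (inverse c *\<^sub>R (c *\<^sub>R v))" using c by simp
  also have "\<dots> \<le> c * (inverse c * lfun (c *\<^sub>R v))"
    using c lfun_scaleR_le[of "inverse c" "c *\<^sub>R v"] by (intro mult_left_mono) auto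
  also have "\<dots> = lfun (c *\<^sub>R v)" using c by simp
  finally show ?thesis using lfun_scaleR_le[OF c, of v] by linarith
qed simp

lemma lfun_sum_nonneg: "0 \<le> lfun v + lfun (- v)" for v :: 'a
  using lfun_nonneg[of v] lfun_nonneg[of "- v"] by simp

lemma lfun_le_norm: "lfun v \<le> norm v" for v :: 'a
proof (rule field_le_epsilon)
  fix d :: real assume "0 < d"
  then obtain v1 v2 where *: "0 \<le> v1" "0 \<le> v2" "v = v1 - v2" "max (norm v1) (norm v2) \<le> norm v + d"
    using order_smooth_2[of d v] by blast
  then have "lfun v \<le> norm v2" by (intro lfun_le) auto
  then show "lfun v \<le> norm v + d" using * by linarith
qed

lemma norm_eq_max_lfun: "norm v = max (lfun v) (lfun (- v))" for v :: 'a
proof (rule antisym)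
  show "max (lfun v) (lfun (- v)) \<le> norm v"
    using lfun_le_norm[of v] lfun_le_norm[of "- v"] by simp
  show "norm v \<le> max (lfun v) (lfun (- v))"
  proof (rule field_le_epsilon)
    fix d :: real assume "0 < d"
    then have "lfun v < lfun v + d" "lfun (- v) < lfun (- v) + d" by auto
    then obtain a b where a: "0 \<le> a + v" "norm a < lfun v + d"
      and b: "0 \<le> b + - v" "norm b < lfun (- v) + d" by (meson lfun_lessE)
    have "0 \<le> v - (- a)" "0 \<le> b - v" using a(1) b(1) by (simp_all add: add.commute)
    then have "- a \<le> v" "v \<le> b" by (simp_all only: diff_ge_0_iff_ge)
    then have "norm v \<le> max (norm (- a)) (norm b)" by (rule order_smooth_1)
    then show "norm v \<le> max (lfun v) (lfun (- v)) + d" using a b by auto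
  qed
qed

end


section \<open>Adjoining an order unit\<close>

text \<open>
  A copy of the product type, since the order and norm differ from those of \<open>'a \<times> real\<close>.
\<close>

datatype 'a unitization = Unitization (vec_part: 'a) (scalar_part: real)

definition adjoined_unit :: "'a::zero unitization" where
  "adjoined_unit = Unitization 0 1"

definition unit_embed :: "'a \<Rightarrow> 'a unitization" where
  "unit_embed v = Unitization v 0"

instantiation unitization :: (real_vector) real_vector
begin

definition zero_unitization :: "'a unitization" where
  "0 = Unitization 0 0"

definition plus_unitization :: "'a unitization \<Rightarrow> 'a unitization \<Rightarrow> 'a unitization" where
  "x + y = Unitization (vec_part x + vec_part y) (scalar_part x + scalar_part y)"

definition minus_unitization :: "'a unitization \<Rightarrow> 'a unitization \<Rightarrow> 'a unitization" where
  "x - y = Unitization (vec_part x - vec_part y) (scalar_part x - scalar_part y)"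

definition uminus_unitization :: "'a unitization \<Rightarrow> 'a unitization" where
  "- x = Unitization (- vec_part x) (- scalar_part x)"

definition scaleR_unitization :: "real \<Rightarrow> 'a unitization \<Rightarrow> 'a unitization" where
  "c *\<^sub>R x = Unitization (c *\<^sub>R vec_part x) (c * scalar_part x)"

instance
  by standard
    (simp_all add: zero_unitization_def plus_unitization_def minus_unitization_def
      uminus_unitization_def scaleR_unitization_def algebra_simps)

end

lemma unitization_part_simps [simp]:
  fixes x y :: "'a::real_vector unitization"
  shows "vec_part (0 :: 'a unitization) = 0" "scalar_part (0 :: 'a unitization) = 0"
    "vec_part (x + y) = vec_part x + vec_part y"
    "scalar_part (x + y) = scalar_part x + scalar_part y"
    "vec_part (x - y) = vec_part x - vec_part y"
    "scalar_part (x - y) = scalar_part x - scalar_part y"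
    "vec_part (- x) = - vec_part x" "scalar_part (- x) = - scalar_part x"
    "vec_part (c *\<^sub>R x) = c *\<^sub>R vec_part x" "scalar_part (c *\<^sub>R x) = c * scalar_part x"
    "vec_part (adjoined_unit :: 'a unitization) = 0"
    "scalar_part (adjoined_unit :: 'a unitization) = 1"
    "vec_part (unit_embed v) = v" "scalar_part (unit_embed v) = 0"
  by (simp_all add: zero_unitization_def plus_unitization_def minus_unitization_def
      uminus_unitization_def scaleR_unitization_def adjoined_unit_def unit_embed_def)

definition unitization_cone :: "'a::order_smooth_inf_normed unitization set" where
  "unitization_cone = {Unitization v \<alpha> | v \<alpha>. lfun v \<le> \<alpha>}"

lemma unitization_cone_iff: "x \<in> unitization_cone \<longleftrightarrow> lfun (vec_part x) \<le> scalar_part x"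
  by (cases x) (auto simp: unitization_cone_def)

instantiation unitization :: (order_smooth_inf_normed) ord
begin

definition less_eq_unitization :: "'a unitization \<Rightarrow> 'a unitization \<Rightarrow> bool" where
  "x \<le> y \<longleftrightarrow> y - x \<in> unitization_cone"

definition less_unitization :: "'a unitization \<Rightarrow> 'a unitization \<Rightarrow> bool" where
  "less_unitization x y \<longleftrightarrow> x \<le> y \<and> \<not> y \<le> x"

instance ..

end

instance unitization :: (order_smooth_inf_normed) ordered_real_vector
proof
  fix x y z :: "'a unitization" and a b :: real
  show "x < y \<longleftrightarrow> x \<le> y \<and> \<not> y \<le> x" by (rule less_unitization_def)
  show "x \<le> x" by (simp add: less_eq_unitization_def unitization_cone_iff)
  show "x \<le> z" if "x \<le> y" "y \<le> z"
    using that lfun_add[of "vec_part y - vec_part x" "vec_part z - vec_part y"]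
    by (simp add: less_eq_unitization_def unitization_cone_iff)
  show "x = y" if "x \<le> y" "y \<le> x"
  proof -
    let ?v = "vec_part y - vec_part x" and ?s = "scalar_part y - scalar_part x"
    have *: "lfun ?v \<le> ?s" "lfun (- ?v) \<le> - ?s"
      using that by (simp_all add: less_eq_unitization_def unitization_cone_iff)
    have nn: "0 \<le> lfun ?v" "0 \<le> lfun (- ?v)" by (rule lfun_nonneg)+
    then have "lfun ?v \<le> 0" "lfun (- ?v) \<le> 0" and s: "?s = 0" using * by linarith+
    then have "0 \<le> ?v" "0 \<le> - ?v" by (simp_all only: lfun_nonpos_iff)
    then have "?v = 0" by (simp add: order.antisym)
    with s show ?thesis by (intro unitization.expand) simp
  qed
  show "z + x \<le> z + y" if "x \<le> y"
    using that by (simp add: less_eq_unitization_def)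
  show "a *\<^sub>R x \<le> a *\<^sub>R y" if "x \<le> y" "0 \<le> a"
  proof -
    have "lfun (a *\<^sub>R (vec_part y - vec_part x)) \<le> a * (scalar_part y - scalar_part x)"
      using that by (simp add: lfun_scaleR less_eq_unitization_def unitization_cone_iff mult_left_mono)
    then show ?thesis
      by (simp add: less_eq_unitization_def unitization_cone_iff algebra_simps)
  qed
  show "a *\<^sub>R x \<le> b *\<^sub>R x" if "a \<le> b" "0 \<le> x"
  proof -
    have "lfun ((b - a) *\<^sub>R vec_part x) \<le> (b - a) * scalar_part x"
      using that
      by (subst lfun_scaleR) (simp_all add: less_eq_unitization_def unitization_cone_iff mult_left_mono)
    then show ?thesis
      by (simp add: less_eq_unitization_def unitization_cone_iff algebra_simps)
  qed
qed

lemma unitization_nonneg_iff: "0 \<le> x \<longleftrightarrow> lfun (vec_part x) \<le> scalar_part x"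
  by (simp add: less_eq_unitization_def unitization_cone_iff)

lemma positive_cone_unitization: "positive_cone = unitization_cone"
  by (auto simp: unitization_nonneg_iff unitization_cone_iff)

lemma order_unit_norm_unitization:
  fixes x :: "'a::order_smooth_inf_normed unitization"
  shows "order_unit_norm adjoined_unit x =
    max (lfun (vec_part x) - scalar_part x) (lfun (- vec_part x) + scalar_part x)"
    (is "_ = ?m")
proof -
  have "{t. 0 < t \<and> 0 \<le> t *\<^sub>R adjoined_unit + x \<and> 0 \<le> t *\<^sub>R adjoined_unit - x} = {t. 0 < t \<and> ?m \<le> t}"
    by (auto simp: unitization_nonneg_iff)
  moreover have "0 \<le> ?m"
    using lfun_sum_nonneg[of "vec_part x"] by linarith
  moreover have "Inf {t::real. 0 < t \<and> m \<le> t} = m" if "0 \<le> m" for m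
  proof (cases "m = 0")
    case True
    then have "{t. 0 < t \<and> m \<le> t} = {0<..}" by auto
    with True show ?thesis by simp
  next
    case False
    with that have "{t. 0 < t \<and> m \<le> t} = {m..}" by auto
    then show ?thesis by simp
  qed
  ultimately show ?thesis unfolding order_unit_norm_eq by metis
qed

instantiation unitization :: (order_smooth_inf_normed) real_normed_vector
begin

definition norm_unitization :: "'a unitization \<Rightarrow> real" where
  "norm x = order_unit_norm adjoined_unit x"

definition sgn_unitization :: "'a unitization \<Rightarrow> 'a unitization" where
  "sgn_unitization x = x /\<^sub>R norm x"

definition dist_unitization :: "'a unitization \<Rightarrow> 'a unitization \<Rightarrow> real" where
  "dist_unitization x y = norm (x - y)"

definition uniformity_unitization :: "('a unitization \<times> 'a unitization) filter" where
  "uniformity_unitization = (INF e\<in>{0 <..}. principal {(x, y). dist x y < e})"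

definition open_unitization :: "'a unitization set \<Rightarrow> bool" where
  "open_unitization U \<longleftrightarrow> (\<forall>x\<in>U. \<forall>\<^sub>F (x', y) in uniformity. x' = x \<longrightarrow> y \<in> U)"

instance
proof
  fix x y :: "'a unitization" and c :: real
  note n = norm_unitization_def order_unit_norm_unitization
  show "norm x = 0 \<longleftrightarrow> x = 0"
  proof
    assume "norm x = 0"
    then have "lfun (vec_part x) \<le> scalar_part x" "lfun (vec_part (- x)) \<le> scalar_part (- x)"
      by (auto simp: n max_def split: if_splits)
    then have "0 \<le> x" "0 \<le> - x" by (simp_all only: unitization_nonneg_iff)
    then show "x = 0" by (simp add: order.antisym)
  qed (simp add: n)
  show "norm (x + y) \<le> norm x + norm y"
    using lfun_add[of "vec_part x" "vec_part y"] lfun_add[of "- vec_part x" "- vec_part y"]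
    unfolding n by (simp add: max_def)
  have pos: "norm (a *\<^sub>R z) = a * norm z" if "0 \<le> a" for a and z :: "'a unitization"
    using that lfun_scaleR[of a "vec_part z"] lfun_scaleR[of a "- vec_part z"]
    by (simp add: n max_mult_distrib_left algebra_simps)
  have minus: "norm (- z) = norm z" for z :: "'a unitization"
    by (simp add: n max.commute)
  show "norm (c *\<^sub>R x) = \<bar>c\<bar> * norm x"
  proof (cases "0 \<le> c")
    case False
    then have "norm (c *\<^sub>R x) = norm (\<bar>c\<bar> *\<^sub>R (- x))" by simp
    also have "\<dots> = \<bar>c\<bar> * norm x" by (simp only: pos minus abs_ge_zero)
    finally show ?thesis .
  qed (simp add: pos)
qed (simp_all add: sgn_unitization_def dist_unitization_def uniformity_unitization_def
    open_unitization_def)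

end

lemma norm_unitization_eq:
  "norm x = max (lfun (vec_part x) - scalar_part x) (lfun (- vec_part x) + scalar_part x)"
  by (simp add: norm_unitization_def order_unit_norm_unitization)

lemma abs_scalar_part_le: "\<bar>scalar_part x\<bar> \<le> norm x"
  for x :: "'a::order_smooth_inf_normed unitization"
  using lfun_nonneg[of "vec_part x"] lfun_nonneg[of "- vec_part x"]
  by (auto simp: norm_unitization_eq)

lemma norm_vec_part_le: "norm (vec_part x) \<le> 2 * norm x"
proof -
  have "lfun (vec_part x) - scalar_part x \<le> norm x" "lfun (- vec_part x) + scalar_part x \<le> norm x"
    by (simp_all add: norm_unitization_eq)
  with abs_scalar_part_le[of x] show ?thesis
    unfolding norm_eq_max_lfun[of "vec_part x"] by (intro max.boundedI) linarith+
qed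

lemma norm_unitization_le: "norm x \<le> norm (vec_part x) + \<bar>scalar_part x\<bar>"
  unfolding norm_eq_max_lfun[of "vec_part x"] norm_unitization_eq by linarith

instance unitization :: ("{order_smooth_inf_normed, banach}") banach
proof
  fix X :: "nat \<Rightarrow> 'a unitization"
  assume X: "Cauchy X"
  have "bounded_linear (vec_part :: 'a unitization \<Rightarrow> 'a)"
    by (rule bounded_linear_intro[where K = 2]) (use norm_vec_part_le in \<open>auto simp: mult.commute\<close>)
  then have "Cauchy (\<lambda>n. vec_part (X n))"
    using X by (rule bounded_linear.Cauchy)
  then obtain v where v: "(\<lambda>n. vec_part (X n)) \<longlonglongrightarrow> v"
    using Cauchy_convergent convergent_def by blast
  have "bounded_linear (scalar_part :: 'a unitization \<Rightarrow> real)"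
    by (rule bounded_linear_intro[where K = 1]) (use abs_scalar_part_le in auto)
  then have "Cauchy (\<lambda>n. scalar_part (X n))"
    using X by (rule bounded_linear.Cauchy)
  then obtain s where s: "(\<lambda>n. scalar_part (X n)) \<longlonglongrightarrow> s"
    using Cauchy_convergent convergent_def by blast
  have lim: "(\<lambda>n. norm (vec_part (X n) - v) + \<bar>scalar_part (X n) - s\<bar>) \<longlonglongrightarrow> 0"
    using tendsto_add[OF tendsto_norm[OF v[THEN LIM_zero]] tendsto_rabs[OF s[THEN LIM_zero]]]
    by simp
  have "(\<lambda>n. X n - Unitization v s) \<longlonglongrightarrow> 0"
    by (rule Lim_null_comparison[OF _ lim])
      (auto intro!: always_eventually order_trans[OF norm_unitization_le])
  then show "convergent X"
    unfolding convergent_def using LIM_zero_cancel by blast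
qed

text \<open>
  \<open>(unitization, adjoined_unit)\<close> is an order unit space, and \<open>unit_embed\<close> is an isometric order
  isomorphism onto its range.
\<close>

lemma order_unit_adjoined_unit: "order_unit (adjoined_unit :: 'a::order_smooth_inf_normed unitization)"
  unfolding order_unit_def approx_order_unit_def
proof (intro conjI ballI impI allI)
  show "directed_set UNIV ((=) :: unit \<Rightarrow> unit \<Rightarrow> bool)"
    by (auto simp: directed_set_def)
  fix x :: "'a unitization"
  have "0 \<le> (norm x + 1) *\<^sub>R adjoined_unit + x" "0 \<le> (norm x + 1) *\<^sub>R adjoined_unit - x"
    by (auto simp: unitization_nonneg_iff norm_unitization_eq)
  then show "\<exists>t>0. \<exists>i\<in>UNIV. 0 \<le> t *\<^sub>R adjoined_unit + x \<and> 0 \<le> t *\<^sub>R adjoined_unit - x"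
    by (intro exI[of _ "norm x + 1"]) (auto intro: add_nonneg_pos)
qed (auto simp: unitization_nonneg_iff)

lemma unitization_archimedean:
  fixes x :: "'a::order_smooth_inf_normed unitization"
  assumes "\<And>t. 0 < t \<Longrightarrow> 0 \<le> t *\<^sub>R adjoined_unit + x"
  shows "0 \<le> x"
proof -
  have "lfun (vec_part x) \<le> scalar_part x + t" if "0 < t" for t
    using assms[OF that] by (simp add: unitization_nonneg_iff)
  then show ?thesis unfolding unitization_nonneg_iff by (rule field_le_epsilon)
qed

lemma linear_unit_embed: "linear (unit_embed :: 'a::real_vector \<Rightarrow> 'a unitization)"
  by (rule linearI) (rule unitization.expand; simp)+

lemma norm_unit_embed: "norm (unit_embed v) = norm v" for v :: "'a::order_smooth_inf_normed"
  by (simp add: norm_unitization_eq norm_eq_max_lfun[of v])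

lemma unit_embed_nonneg_iff: "0 \<le> unit_embed v \<longleftrightarrow> 0 \<le> v"
  by (simp add: unitization_nonneg_iff lfun_nonpos_iff)


section \<open>L-summands and M-ideals\<close>

definition L_summand :: "'b::banach set \<Rightarrow> bool" where
  "L_summand X \<longleftrightarrow> subspace X \<and> closed X \<and>
     (\<exists>Y. subspace Y \<and> closed Y \<and> X \<inter> Y = {0} \<and>
        (\<forall>z. \<exists>x\<in>X. \<exists>y\<in>Y. z = x + y) \<and>
        (\<forall>x\<in>X. \<forall>y\<in>Y. norm (x + y) = norm x + norm y))"

definition annihilator :: "'b::real_normed_vector set \<Rightarrow> ('b \<Rightarrow>\<^sub>L real) set" where
  "annihilator W = {f. \<forall>w\<in>W. blinfun_apply f w = 0}"

definition M_ideal :: "'b::banach set \<Rightarrow> bool" where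
  "M_ideal W \<longleftrightarrow> subspace W \<and> closed W \<and> L_summand (annihilator W)"

end

theory Submission
  imports Defs
begin

text \<open>
  Both properties are equivalent to the positive part of the open unit ball of \<open>V\<close> being upward
  directed.

  The annihilator of \<open>V\<close> in the dual of the unitization is spanned by the scalar part \<open>\<phi>\<close>. If it
  is an L-summand with complement \<open>Y\<close>, then for positive \<open>f\<close> on \<open>V\<close> the extension taking the value
  \<open>norm f\<close> at the adjoined unit has norm \<open>norm f\<close> and therefore lies in \<open>Y\<close>; as \<open>Y\<close> is a subspace
  not containing \<open>\<phi>\<close>, the norm is additive on positive functionals. A Hahn-Banach argument on
  \<open>V \<times> V\<close> turns this into directedness. Conversely, when the positive part of the ball is directed,
  every bounded functional converges along it, and the complement consists of the functionals
  \<open>g\<close> with \<open>g (1 - e) \<longlonglongrightarrow> 0\<close>.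
\<close>

section \<open>The Hahn-Banach theorem\<close>

definition sublinear :: "('a::real_vector \<Rightarrow> real) \<Rightarrow> bool" where
  "sublinear p \<longleftrightarrow> (\<forall>x y. p (x + y) \<le> p x + p y) \<and> (\<forall>c x. 0 \<le> c \<longrightarrow> p (c *\<^sub>R x) = c * p x)"

lemma sublinear_add: "sublinear p \<Longrightarrow> p (x + y) \<le> p x + p y"
  and sublinear_scaleR: "sublinear p \<Longrightarrow> 0 \<le> c \<Longrightarrow> p (c *\<^sub>R x) = c * p x"
  by (simp_all add: sublinear_def)

lemma sublinear_zero: "sublinear p \<Longrightarrow> p 0 = 0"
  using sublinear_scaleR[of p 0 0] by simp

lemma sublinear_minus: "sublinear p \<Longrightarrow> - p (- x) \<le> p x"
  using sublinear_add[of p x "- x"] sublinear_zero[of p] by simp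

text \<open>An upper bound is enough for homogeneity: applying \<open>scale\<close> with
  \<open>inverse c\<close> at \<open>c *\<^sub>R x\<close> yields the reverse inequality.\<close>

lemma sublinearI:
  fixes p :: "'a::real_vector \<Rightarrow> real"
  assumes add: "\<And>x y. p (x + y) \<le> p x + p y"
    and scale: "\<And>c x. 0 < c \<Longrightarrow> p (c *\<^sub>R x) \<le> c * p x"
    and zero: "p 0 = 0"
  shows "sublinear p"
  unfolding sublinear_def
proof (intro conjI allI impI)
  fix c :: real and x :: 'a
  assume "0 \<le> c"
  show "p (c *\<^sub>R x) = c * p x"
  proof (cases "c = 0")
    case False
    with \<open>0 \<le> c\<close> have c: "0 < c" by simp
    have "p x \<le> inverse c * p (c *\<^sub>R x)"
      using scale[of "inverse c" "c *\<^sub>R x"] c by simp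
    then show ?thesis using scale[OF c, of x] c by (simp add: field_simps)
  qed (simp add: zero)
qed (rule add)

text \<open>The value at \<open>- y\<close> is lowered just so far that every linear
  \<open>f \<le> q\<close> satisfies \<open>f y = p y\<close>. The same device, applied at each
  point of a minimal functional, shows that it is odd.\<close>

lemma sublinear_below:
  fixes p :: "'a::real_vector \<Rightarrow> real"
  assumes p: "sublinear p"
  obtains q where "sublinear q" "q \<le> p" "q (- y) \<le> - p y"
proof -
  \<comment> \<open>The parameter \<open>t = 0\<close> gives \<open>q \<le> p\<close>, and
    \<open>t = 1\<close> gives the bound at \<open>- y\<close>.\<close>
  define S where "S x = (\<lambda>t. p (x + t *\<^sub>R y) - t * p y) ` {0..}" for x
  define q where "q x = Inf (S x)" for x
  \<comment> \<open>A lower bound independent of \<open>t\<close>, so the infimum is finite.\<close>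
  have "- p (- x) \<le> p (x + t *\<^sub>R y) - t * p y" if "0 \<le> t" for x t
    using sublinear_add[OF p, of "x + t *\<^sub>R y" "- x"] sublinear_scaleR[OF p that, of y] by simp
  then have "bdd_below (S x)" for x
    unfolding S_def by (intro bdd_belowI[of _ "- p (- x)"]) auto
  then have le: "q x \<le> p (x + t *\<^sub>R y) - t * p y" if "0 \<le> t" for x t
    unfolding q_def by (intro cInf_lower) (use that in \<open>auto simp: S_def\<close>)
  have ge: "c \<le> q x" if "\<And>t. 0 \<le> t \<Longrightarrow> c \<le> p (x + t *\<^sub>R y) - t * p y" for c x
    unfolding q_def S_def by (rule cInf_greatest) (use that in auto)
  show thesis
  proof (rule that)
    show "q \<le> p" using le[of 0] by (simp add: le_fun_def)
    show "q (- y) \<le> - p y" using le[of 1 "- y"] by (simp add: sublinear_zero[OF p])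
    show "sublinear q"
    proof (rule sublinearI)
      fix x z
      \<comment> \<open>The parameters \<open>t\<close> for \<open>x\<close> and \<open>s\<close>
        for \<open>z\<close> combine to \<open>t + s\<close> for \<open>x + z\<close>; infima are
        then taken over \<open>s\<close> and \<open>t\<close> in turn.\<close>
      have "q (x + z) - (p (x + t *\<^sub>R y) - t * p y) \<le> p (z + s *\<^sub>R y) - s * p y"
        if "0 \<le> t" "0 \<le> s" for s t
        using le[of "t + s" "x + z"] that sublinear_add[OF p, of "x + t *\<^sub>R y" "z + s *\<^sub>R y"]
        by (simp add: algebra_simps)
      then have "q (x + z) - q z \<le> p (x + t *\<^sub>R y) - t * p y" if "0 \<le> t" for t
        using that ge[of "q (x + z) - (p (x + t *\<^sub>R y) - t * p y)" z] by force
      then have "q (x + z) - q z \<le> q x" by (rule ge)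
      then show "q (x + z) \<le> q x + q z" by simp
    next
      fix c :: real and x
      assume c: "0 < c"
      have "q (c *\<^sub>R x) / c \<le> q x"
      proof (rule ge)
        fix t :: real assume "0 \<le> t"
        then have "q (c *\<^sub>R x) \<le> p (c *\<^sub>R (x + t *\<^sub>R y)) - c * t * p y"
          using le[of "c * t" "c *\<^sub>R x"] c by (simp add: scaleR_add_right)
        then show "q (c *\<^sub>R x) / c \<le> p (x + t *\<^sub>R y) - t * p y"
          using c sublinear_scaleR[OF p, of c "x + t *\<^sub>R y"] by (simp add: field_simps)
      qed
      then show "q (c *\<^sub>R x) \<le> c * q x" using c by (simp add: field_simps)
    next
      show "q 0 = 0"
        using le[of 0 0] ge[of 0 0] by (simp add: sublinear_zero[OF p] sublinear_scaleR[OF p])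
    qed
  qed
qed

text \<open>Zorn's lemma for the reversed pointwise order: the pointwise infimum of a chain of
  sublinear functionals is sublinear.\<close>

lemma sublinear_minimal:
  fixes p :: "'a::real_vector \<Rightarrow> real"
  assumes p: "sublinear p"
  obtains q where "sublinear q" "q \<le> p" "\<And>r. sublinear r \<Longrightarrow> r \<le> q \<Longrightarrow> r = q"
proof -
  define A where "A = {q. sublinear q \<and> q \<le> p}"
  have "\<exists>m\<in>A. \<forall>a\<in>A. a \<le> m \<longrightarrow> a = m"
  proof (rule predicate_Zorn[where P = "\<lambda>a b. b \<le> a"])
    show "partial_order_on A (relation_of (\<lambda>a b. b \<le> a) A)"
      by (rule partial_order_on_relation_ofI) auto
    fix C assume "C \<in> Chains (relation_of (\<lambda>a b. b \<le> a) A)"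
    then have CA: "C \<subseteq> A" and lin: "\<And>a b. a \<in> C \<Longrightarrow> b \<in> C \<Longrightarrow> a \<le> b \<or> b \<le> a"
      unfolding Chains_def relation_of_def by blast+
    show "\<exists>u\<in>A. \<forall>a\<in>C. u \<le> a"
    proof (cases "C = {}")
      case True
      then show ?thesis using p by (auto simp: A_def)
    next
      case False
      define u where "u x = (INF a\<in>C. a x)" for x
      have sub: "sublinear a" and ap: "a x \<le> p x" if "a \<in> C" for a x
        using that CA by (auto simp: A_def le_fun_def)
      \<comment> \<open>The bound does not depend on \<open>a\<close>, so the infimum over the chain
        is finite.\<close>
      have "- p (- x) \<le> a x" if "a \<in> C" for a x
        using sublinear_minus[OF sub[OF that], of x] ap[OF that, of "- x"] by simp
      then have le: "u x \<le> a x" if "a \<in> C" for a x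
        unfolding u_def using that by (intro cINF_lower bdd_belowI2)
      have ge: "c \<le> u x" if "\<And>a. a \<in> C \<Longrightarrow> c \<le> a x" for c x
        unfolding u_def using False that by (rule cINF_greatest)
      have "sublinear u"
      proof (rule sublinearI)
        fix x y
        \<comment> \<open>Subadditivity of the infimum uses the chain: the smaller of
          \<open>a\<close> and \<open>b\<close> lies below both.\<close>
        have "u (x + y) - a x \<le> b y" if ab: "a \<in> C" "b \<in> C" for a b
        proof -
          obtain c where c: "c \<in> C" "c \<le> a" "c \<le> b" using lin[OF ab] ab by blast
          have "u (x + y) \<le> c x + c y"
            using le[OF c(1), of "x + y"] sublinear_add[OF sub[OF c(1)], of x y] by linarith
          also have "\<dots> \<le> a x + b y" using c by (intro add_mono) (auto simp: le_fun_def)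
          finally show ?thesis by simp
        qed
        then have "u (x + y) - a x \<le> u y" if "a \<in> C" for a using that by (blast intro: ge)
        then have "u (x + y) - u y \<le> u x" by (force intro: ge)
        then show "u (x + y) \<le> u x + u y" by simp
      next
        fix c :: real and x assume c: "0 < c"
        have "u (c *\<^sub>R x) / c \<le> u x"
          by (rule ge) (use le[of _ "c *\<^sub>R x"] c in \<open>auto simp: sub sublinear_scaleR field_simps\<close>)
        then show "u (c *\<^sub>R x) \<le> c * u x" using c by (simp add: field_simps)
      next
        have "a 0 = 0" if "a \<in> C" for a using sublinear_zero[OF sub[OF that]] .
        then have "(\<lambda>a. a 0) ` C = {0}" using False by force
        then show "u 0 = 0" by (simp add: u_def)
      qed
      moreover from False obtain a where "a \<in> C" by blast
      then have "u \<le> p" using le ap order_trans by (fastforce simp: le_fun_def)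
      ultimately show ?thesis using le by (auto simp: A_def le_fun_def)
    qed
  qed
  then show thesis using that unfolding A_def by (blast intro: order_trans)
qed

text \<open>A minimal sublinear functional below \<open>p\<close> is linear.\<close>

lemma hahn_banach_sublinear:
  fixes p :: "'a::real_vector \<Rightarrow> real"
  assumes p: "sublinear p"
  obtains f where "linear f" "\<And>x. f x \<le> p x" "f y = p y"
proof -
  \<comment> \<open>Passing to \<open>p'\<close> first forces \<open>f y = p y\<close> for whatever
    linear \<open>f\<close> is found below it.\<close>
  obtain p' where p': "sublinear p'" "p' \<le> p" "p' (- y) \<le> - p y"
    using sublinear_below[OF p] .
  obtain f where f: "sublinear f" "f \<le> p'" and min: "\<And>r. sublinear r \<Longrightarrow> r \<le> f \<Longrightarrow> r = f"
    using sublinear_minimal[OF p'(1)] by blast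
  have neg: "f (- x) = - f x" for x
  proof (rule antisym)
    \<comment> \<open>Minimality identifies the lowered functional \<open>r\<close> with
      \<open>f\<close>, so its bound at \<open>- x\<close> holds for \<open>f\<close>.\<close>
    obtain r where r: "sublinear r" "r \<le> f" "r (- x) \<le> - f x" using sublinear_below[OF f(1)] .
    with min show "f (- x) \<le> - f x" by blast
    show "- f x \<le> f (- x)" using sublinear_minus[OF f(1), of "- x"] by simp
  qed
  show thesis
  proof (rule that)
    show "linear f"
    proof (rule linearI)
      fix x z
      show "f (x + z) = f x + f z"
        using sublinear_add[OF f(1), of x z] sublinear_add[OF f(1), of "x + z" "- z"] neg[of z]
        by simp
    next
      fix c :: real and x
      show "f (c *\<^sub>R x) = c *\<^sub>R f x"
      proof (cases "0 \<le> c")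
        case False
        then have "f (c *\<^sub>R x) = f (- ((- c) *\<^sub>R x))" by simp
        also have "\<dots> = c * f x" using False by (simp only: neg sublinear_scaleR[OF f(1)])
        finally show ?thesis by simp
      qed (simp add: sublinear_scaleR[OF f(1)])
    qed
    show fp: "f x \<le> p x" for x using f(2) p'(2) by (meson le_funD order_trans)
    have "- f y \<le> - p y" using f(2) p'(3) neg[of y] by (metis le_funD order_trans)
    then show "f y = p y" using fp[of y] by simp
  qed
qed

section \<open>Directedness of the positive part of the unit ball\<close>

text \<open>The ball is open to leave room for the \<open>\<epsilon>\<close> in
  \<open>order_smooth_2\<close> and for infima that are not attained.\<close>

definition pos_ball :: "'a::{ordered_real_vector, real_normed_vector} set" where
  "pos_ball = {u. 0 \<le> u \<and> norm u < 1}"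

lemma directed_pos_ball_iff:
  "directed_set (pos_ball :: 'a::{ordered_real_vector, real_normed_vector} set) (\<le>) \<longleftrightarrow>
    (\<forall>u\<in>pos_ball. \<forall>w\<in>pos_ball. \<exists>k\<in>(pos_ball :: 'a set). u \<le> k \<and> w \<le> k)"
proof -
  have "(0::'a) \<in> pos_ball" by (simp add: pos_ball_def)
  then show ?thesis unfolding directed_set_def by (auto intro: order_trans)
qed

lemma directed_pos_ball_dominates:
  fixes v :: "'a::order_smooth_inf_normed"
  assumes dir: "directed_set (pos_ball :: 'a set) (\<le>)" and v: "norm v < 1"
  obtains e where "e \<in> pos_ball" "- e \<le> v" "v \<le> e"
proof -
  \<comment> \<open>Taking half of the gap to 1 keeps both parts inside the open ball.\<close>
  obtain v1 v2 where *: "0 \<le> v1" "0 \<le> v2" "v = v1 - v2"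
    "max (norm v1) (norm v2) \<le> norm v + (1 - norm v) / 2"
    using order_smooth_2[of "(1 - norm v) / 2" v] v by auto
  then have "v1 \<in> pos_ball" "v2 \<in> pos_ball" using v by (auto simp: pos_ball_def field_simps)
  then obtain e where e: "e \<in> pos_ball" "v1 \<le> e" "v2 \<le> e"
    using dir unfolding directed_pos_ball_iff by blast
  have "- e \<le> - v2" using e by simp
  also have "\<dots> \<le> v" using * by simp
  finally have "- e \<le> v" .
  moreover have "v \<le> v1" using * by simp
  ultimately show thesis using that e by (meson order_trans)
qed

text \<open>From left to right, every ball element lies below some \<open>t *\<^sub>R e i\<close>
  with \<open>t < 1\<close>, and such multiples stay in the ball. From right to left, the ball
  indexed by itself is the approximate order unit.\<close>

lemma approx_order_unit_space_iff_directed: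
  "approx_order_unit_space TYPE('a::order_smooth_inf_normed) \<longleftrightarrow>
    directed_set (pos_ball :: 'a set) (\<le>)"
proof
  assume "approx_order_unit_space TYPE('a)"
  then obtain I r and e :: "'a \<Rightarrow> 'a" where au: "approx_order_unit I r e"
    and n: "\<And>v. norm v = approx_order_unit_seminorm I e v"
    unfolding approx_order_unit_space_def by blast
  define T where "T v = {t. 0 < t \<and> (\<exists>i\<in>I. 0 \<le> t *\<^sub>R e i + v \<and> 0 \<le> t *\<^sub>R e i - v)}" for v
  have nT: "norm v = Inf (T v)" for v by (simp add: n T_def approx_order_unit_seminorm_def)
  have T_ne: "T v \<noteq> {}" for v using au unfolding approx_order_unit_def T_def by blast
  have e0: "0 \<le> e i" if "i \<in> I" for i using au that by (simp add: approx_order_unit_def)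
  \<comment> \<open>The value 1 is admissible in \<open>T (e i)\<close>, witnessed by the index
    \<open>i\<close> itself.\<close>
  have e_norm: "norm (e i) \<le> 1" if "i \<in> I" for i
    unfolding nT by (rule cInf_lower) (use that e0 in \<open>auto simp: T_def intro!: bdd_belowI[of _ 0]\<close>)
  have dom: "\<exists>t<1. 0 < t \<and> (\<exists>i\<in>I. u \<le> t *\<^sub>R e i)" if "u \<in> pos_ball" for u
  proof -
    have "Inf (T u) < 1" using that by (simp add: pos_ball_def flip: nT)
    then obtain t where "t \<in> T u" "t < 1" using cInf_lessD[OF T_ne] by blast
    then show ?thesis by (auto simp: T_def)
  qed
  show "directed_set (pos_ball :: 'a set) (\<le>)"
    unfolding directed_pos_ball_iff
  proof (intro ballI)
    fix u w :: 'a assume uw: "u \<in> pos_ball" "w \<in> pos_ball"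
    obtain s i where s: "s < 1" "0 < s" "i \<in> I" "u \<le> s *\<^sub>R e i" using dom[OF uw(1)] by blast
    obtain t j where t: "t < 1" "0 < t" "j \<in> I" "w \<le> t *\<^sub>R e j" using dom[OF uw(2)] by blast
    obtain k where k: "k \<in> I" "r i k" "r j k"
      using au s t unfolding approx_order_unit_def directed_set_def by blast
    then have ek: "e i \<le> e k" "e j \<le> e k" using au s t unfolding approx_order_unit_def by blast+
    let ?m = "max s t"
    have "s *\<^sub>R e i \<le> ?m *\<^sub>R e k" "t *\<^sub>R e j \<le> ?m *\<^sub>R e k"
      using s t ek e0 by (auto intro!: scaleR_mono)
    moreover have "norm (?m *\<^sub>R e k) < 1"
    proof -
      have "norm (?m *\<^sub>R e k) \<le> ?m * 1"
        using s e_norm[OF k(1)] by (simp add: mult_left_le)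
      then show ?thesis using s t by linarith
    qed
    moreover have "0 \<le> ?m *\<^sub>R e k" using s e0[OF k(1)] by (simp add: scaleR_nonneg_nonneg)
    ultimately show "\<exists>k\<in>pos_ball. u \<le> k \<and> w \<le> k"
      using s t by (intro bexI[of _ "?m *\<^sub>R e k"]) (auto simp: pos_ball_def intro: order_trans)
  qed
next
  assume dir: "directed_set (pos_ball :: 'a set) (\<le>)"
  \<comment> \<open>Dividing by \<open>t\<close> moves \<open>v\<close> into the open unit ball,
    where a ball element dominates it from both sides.\<close>
  have dom: "\<exists>i\<in>pos_ball. 0 \<le> t *\<^sub>R i + v \<and> 0 \<le> t *\<^sub>R i - v" if t: "norm v < t" for t and v :: 'a
  proof -
    have t0: "0 < t" using t norm_ge_zero[of v] by linarith
    have "norm (inverse t *\<^sub>R v) < 1" using t t0 by (simp add: field_simps)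
    then obtain e where e: "e \<in> pos_ball" "- e \<le> inverse t *\<^sub>R v" "inverse t *\<^sub>R v \<le> e"
      using directed_pos_ball_dominates[OF dir] by blast
    have "t *\<^sub>R (inverse t *\<^sub>R v) = v" using t0 by simp
    then have "- (t *\<^sub>R e) \<le> v" "v \<le> t *\<^sub>R e"
      using scaleR_left_mono[OF e(2), of t] scaleR_left_mono[OF e(3), of t] t0
      by (simp_all only: scaleR_minus_right less_imp_le)
    then have "0 \<le> t *\<^sub>R e + v" "0 \<le> t *\<^sub>R e - v"
      using add_left_mono[of "- (t *\<^sub>R e)" v "t *\<^sub>R e"] by simp_all
    with e show ?thesis by blast
  qed
  show "approx_order_unit_space TYPE('a)"
  proof (rule approx_order_unit_spaceI[where e = "\<lambda>x. x"])
    show "approx_order_unit (pos_ball :: 'a set) (\<le>) (\<lambda>x. x)"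
      unfolding approx_order_unit_def
    proof (intro conjI dir ballI impI allI)
      fix v :: 'a
      show "\<exists>t>0. \<exists>i\<in>pos_ball. 0 \<le> t *\<^sub>R i + v \<and> 0 \<le> t *\<^sub>R i - v"
        using dom[of v "norm v + 1"] by (intro exI[of _ "norm v + 1"]) (auto intro: add_nonneg_pos)
    qed (auto simp: pos_ball_def)
    fix v :: 'a
    let ?T = "{t. 0 < t \<and> (\<exists>i\<in>pos_ball. 0 \<le> t *\<^sub>R i + v \<and> 0 \<le> t *\<^sub>R i - v)}"
    have "Inf ?T = norm v"
    proof (rule antisym)
      show "Inf ?T \<le> norm v"
      proof (rule field_le_epsilon)
        fix d :: real assume d: "0 < d"
        then have "norm v + d \<in> ?T" using dom[of v "norm v + d"] by (auto intro: add_nonneg_pos)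
        then show "Inf ?T \<le> norm v + d"
          by (rule cInf_lower) (auto intro: bdd_belowI[of _ 0])
      qed
      have "norm v + 1 \<in> ?T" using dom[of v "norm v + 1"] by (auto intro: add_nonneg_pos)
      then have "?T \<noteq> {}" by blast
      then show "norm v \<le> Inf ?T"
      proof (rule cInf_greatest)
        fix t assume "t \<in> ?T"
        then obtain i where t: "0 < t" and i: "i \<in> pos_ball" "0 \<le> t *\<^sub>R i + v" "0 \<le> t *\<^sub>R i - v"
          by blast
        have "- (t *\<^sub>R i) \<le> v" "v \<le> t *\<^sub>R i"
          using add_left_mono[OF i(2), of "- (t *\<^sub>R i)"] i(3) by simp_all
        \<comment> \<open>Order smoothness supplies the inequality saying that no admissible
          \<open>t\<close> is below the norm.\<close>
        then have "norm v \<le> max (norm (- (t *\<^sub>R i))) (norm (t *\<^sub>R i))" by (rule order_smooth_1)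
        also have "\<dots> = t * norm i" using t by simp
        also have "\<dots> \<le> t" using t i(1) by (simp add: pos_ball_def mult_left_le)
        finally show "norm v \<le> t" .
      qed
    qed
    then show "norm v = approx_order_unit_seminorm pos_ball (\<lambda>x. x) v"
      by (simp add: approx_order_unit_seminorm_def)
  qed
qed

section \<open>Positive functionals\<close>

lemma bounded_linear_vec_part:
  "bounded_linear (vec_part :: 'a::order_smooth_inf_normed unitization \<Rightarrow> 'a)"
  by (rule bounded_linear_intro[where K = 2]) (use norm_vec_part_le in \<open>auto simp: mult.commute\<close>)

lemma bounded_linear_scalar_part:
  "bounded_linear (scalar_part :: 'a::order_smooth_inf_normed unitization \<Rightarrow> real)"
  by (rule bounded_linear_intro[where K = 1]) (use abs_scalar_part_le in auto)

lemma bounded_linear_unit_embed: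
  "bounded_linear (unit_embed :: 'a::order_smooth_inf_normed \<Rightarrow> 'a unitization)"
  using linear_unit_embed by (rule bounded_linear.intro[OF _ bounded_linear_axioms.intro])
    (auto simp: norm_unit_embed intro!: exI[of _ 1])

text \<open>For every positive \<open>u\<close> above \<open>v\<close>, positivity gives
  \<open>f v \<le> f u \<le> c * norm u\<close>; the infimum of \<open>norm u\<close> over such
  \<open>u\<close> is \<open>lfun (- v)\<close>.\<close>

lemma positive_functional_le_lfun:
  fixes f :: "'a::order_smooth_inf_normed \<Rightarrow> real"
  assumes f: "linear f" and pos: "\<And>v. 0 \<le> v \<Longrightarrow> 0 \<le> f v"
    and bound: "\<And>v. 0 \<le> v \<Longrightarrow> f v \<le> c * norm v" and c: "0 < c"
  shows "f v \<le> c * lfun (- v)"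
proof -
  have "f v / c \<le> lfun (- v)"
  proof (rule lfun_greatest)
    fix u assume "0 \<le> u" "0 \<le> u + - v"
    then show "f v / c \<le> norm u"
      using pos[of "u + - v"] bound[of u] c linear_diff[OF f, of u v] by (simp add: field_simps)
  qed
  then show ?thesis using c by (simp add: field_simps)
qed

text \<open>The estimate by \<open>lfun (- v)\<close> matches the second term of the maximum
  defining the norm of the unitization, so the value \<open>norm f\<close> at the unit does not
  increase the norm.\<close>

lemma positive_functional_extension:
  fixes f :: "'a::order_smooth_inf_normed \<Rightarrow>\<^sub>L real"
  assumes pos: "\<And>v. 0 \<le> v \<Longrightarrow> 0 \<le> f v"
  obtains F :: "'a unitization \<Rightarrow>\<^sub>L real"
  where "\<And>x. F x = f (vec_part x) + norm f * scalar_part x" "norm F \<le> norm f"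
proof -
  have bl: "bounded_linear (\<lambda>x. f (vec_part x) + norm f * scalar_part x)"
    by (intro bounded_linear_add bounded_linear_const_mult bounded_linear_scalar_part
        bounded_linear_compose[OF blinfun.bounded_linear_right bounded_linear_vec_part])
  define F where "F = Blinfun (\<lambda>x. f (vec_part x) + norm f * scalar_part x)"
  have F: "F x = f (vec_part x) + norm f * scalar_part x" for x
    unfolding F_def by (simp add: bounded_linear_Blinfun_apply[OF bl])
  have le_lfun: "f v \<le> norm f * lfun (- v)" for v
  proof (cases "norm f = 0")
    case False
    have "f w \<le> norm f * norm w" for w using norm_blinfun[of f w] by simp
    with False show ?thesis
      by (intro positive_functional_le_lfun pos) (auto intro: bounded_linear.linear[OF blinfun.bounded_linear_right])
  qed simp
  have le: "F x \<le> norm f * norm x" for x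
  proof -
    have "F x \<le> norm f * (lfun (- vec_part x) + scalar_part x)"
      using le_lfun[of "vec_part x"] by (simp add: F algebra_simps)
    also have "\<dots> \<le> norm f * norm x"
      by (intro mult_left_mono) (auto simp: norm_unitization_eq)
    finally show ?thesis .
  qed
  have "norm F \<le> norm f"
  proof (rule norm_blinfun_bound)
    show "norm (F x) \<le> norm f * norm x" for x
      using le[of x] le[of "- x"] by (simp add: blinfun.minus_right abs_le_iff)
  qed simp
  with F show thesis by (rule that)
qed

section \<open>From the M-ideal property to directedness\<close>

lemma M_ideal_norm_add:
  fixes f g :: "'a::{order_smooth_inf_normed, banach} \<Rightarrow>\<^sub>L real"
  assumes M: "M_ideal (range (unit_embed :: 'a \<Rightarrow> 'a unitization))"
    and f: "\<And>v. 0 \<le> v \<Longrightarrow> 0 \<le> f v" and g: "\<And>v. 0 \<le> v \<Longrightarrow> 0 \<le> g v"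
  shows "norm (f + g) = norm f + norm g"
proof -
  let ?X = "annihilator (range (unit_embed :: 'a \<Rightarrow> 'a unitization))"
  obtain Y where Y: "subspace Y" "?X \<inter> Y = {0}" and sum: "\<And>z. \<exists>x\<in>?X. \<exists>y\<in>Y. z = x + y"
    and L: "\<And>x y. x \<in> ?X \<Longrightarrow> y \<in> Y \<Longrightarrow> norm (x + y) = norm x + norm y"
    using M unfolding M_ideal_def L_summand_def by auto
  have ext: "\<exists>F\<in>Y. \<forall>x. F x = h (vec_part x) + norm h * scalar_part x"
    if pos: "\<And>v. 0 \<le> v \<Longrightarrow> 0 \<le> h v" for h :: "'a \<Rightarrow>\<^sub>L real"
  proof -
    obtain F :: "'a unitization \<Rightarrow>\<^sub>L real"
      where F: "\<And>x. F x = h (vec_part x) + norm h * scalar_part x" "norm F \<le> norm h"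
      using positive_functional_extension[OF pos] by blast
    obtain x y where xy: "x \<in> ?X" "y \<in> Y" "F = x + y" using sum by blast
    \<comment> \<open>The component \<open>x\<close> vanishes on \<open>V\<close>, so
      \<open>y\<close> already restricts to \<open>h\<close>. Then
      \<open>norm x + norm y = norm F \<le> norm h \<le> norm y\<close> leaves no room for
      \<open>x\<close>.\<close>
    have "norm h \<le> norm y"
    proof (rule norm_blinfun_bound)
      fix v
      have "h v = F (unit_embed v)" by (simp add: F)
      also have "\<dots> = y (unit_embed v)"
        using xy(1) unfolding xy(3) by (simp add: annihilator_def blinfun.add_left)
      finally show "norm (h v) \<le> norm y * norm v"
        using norm_blinfun[of y "unit_embed v"] by (simp add: norm_unit_embed)
    qed simp
    then have "norm x = 0" using L[OF xy(1,2)] F(2) norm_ge_zero[of x] unfolding xy(3) by linarith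
    with xy F show ?thesis by auto
  qed
  have fg: "0 \<le> (f + g) v" if "0 \<le> v" for v using f g that by (simp add: blinfun.add_left)
  obtain F G H where Y': "F \<in> Y" "G \<in> Y" "H \<in> Y"
    and F: "\<And>x. F x = f (vec_part x) + norm f * scalar_part x"
    and G: "\<And>x. G x = g (vec_part x) + norm g * scalar_part x"
    and H: "\<And>x. H x = (f + g) (vec_part x) + norm (f + g) * scalar_part x"
    using ext[OF f] ext[OF g] ext[OF fg] by metis
  \<comment> \<open>The three extensions agree additively on \<open>V\<close>, so the difference
    lies in both summands and is 0; its value at the unit is the defect of norm additivity.\<close>
  have "F + G - H \<in> ?X"
    by (auto simp: annihilator_def blinfun.add_left blinfun.diff_left F G H)
  moreover have "F + G - H \<in> Y" using Y' Y(1) by (intro subspace_diff subspace_add)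
  ultimately have "F + G - H = 0" using Y(2) by blast
  then have "(F + G - H) adjoined_unit = 0" by simp
  then show ?thesis by (simp add: blinfun.add_left blinfun.diff_left F G H)
qed

text \<open>
  The infimum of \<open>norm k\<close> over the common upper bounds \<open>k\<close> of \<open>u\<close> and \<open>w\<close> is sublinear in
  \<open>(u, w)\<close>; a linear functional below it that touches it at a given pair is a pair of positive
  functionals \<open>f\<close>, \<open>g\<close> with \<open>norm (f + g) \<le> 1\<close>.
\<close>

lemma directed_pos_ball_if_norm_add:
  assumes add: "\<And>(f :: 'a::order_smooth_inf_normed \<Rightarrow>\<^sub>L real) (g :: 'a \<Rightarrow>\<^sub>L real).
    (\<And>v. 0 \<le> v \<Longrightarrow> 0 \<le> blinfun_apply f v) \<Longrightarrow> (\<And>v. 0 \<le> v \<Longrightarrow> 0 \<le> blinfun_apply g v) \<Longrightarrow>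
    norm (f + g) = norm f + norm g"
  shows "directed_set (pos_ball :: 'a set) (\<le>)"
  unfolding directed_pos_ball_iff
proof (intro ballI)
  fix u w :: 'a assume u: "u \<in> pos_ball" and w: "w \<in> pos_ball"
  define B where "B x = {k. 0 \<le> k \<and> fst x \<le> k \<and> snd x \<le> k}" for x :: "'a \<times> 'a"
  define p where "p x = Inf (norm ` B x)" for x
  have B_ne: "B x \<noteq> {}" for x
  proof -
    obtain a b where "0 \<le> a" "0 \<le> b" "fst x = a - b" using cone_generating[of "fst x"] by blast
    moreover obtain c d where "0 \<le> c" "0 \<le> d" "snd x = c - d"
      using cone_generating[of "snd x"] by blast
    ultimately have "a + c \<in> B x" by (auto simp: B_def algebra_simps intro: add_increasing add_increasing2)
    then show ?thesis by blast
  qed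
  have le: "p x \<le> norm k" if "k \<in> B x" for x k
    unfolding p_def by (rule cInf_lower) (use that in \<open>auto intro!: bdd_belowI[of _ 0]\<close>)
  have ge: "c \<le> p x" if "\<And>k. k \<in> B x \<Longrightarrow> c \<le> norm k" for c x
    unfolding p_def by (rule cInf_greatest) (use that B_ne in auto)
  have p: "sublinear p"
  proof (rule sublinearI)
    fix x y
    have "p (x + y) - norm k \<le> norm l" if "k \<in> B x" "l \<in> B y" for k l
    proof -
      have "k + l \<in> B (x + y)" using that by (auto simp: B_def intro: add_mono)
      then show ?thesis using le[of "k + l" "x + y"] norm_triangle_ineq[of k l] by linarith
    qed
    then have "p (x + y) - norm k \<le> p y" if "k \<in> B x" for k using that by (blast intro: ge)
    then have "p (x + y) - p y \<le> p x" by (force intro: ge)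
    then show "p (x + y) \<le> p x + p y" by simp
  next
    fix c :: real and x assume c: "0 < c"
    have "p (c *\<^sub>R x) / c \<le> p x"
    proof (rule ge)
      fix k assume "k \<in> B x"
      then have "c *\<^sub>R k \<in> B (c *\<^sub>R x)"
        using c by (auto simp: B_def intro!: scaleR_left_mono scaleR_nonneg_nonneg)
      then show "p (c *\<^sub>R x) / c \<le> norm k" using le[of "c *\<^sub>R k"] c by (simp add: field_simps)
    qed
    then show "p (c *\<^sub>R x) \<le> c * p x" using c by (simp add: field_simps)
  next
    have "0 \<in> B 0" by (simp add: B_def)
    then show "p 0 = 0" using le[of 0 0] ge[of 0 0] by simp
  qed
  obtain h where h: "linear h" "\<And>x. h x \<le> p x" and huw: "h (u, w) = p (u, w)"
    using hahn_banach_sublinear[OF p] by blast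
  have lin: "linear (\<lambda>v. h (v, 0))" "linear (\<lambda>v. h (0, v))"
    by (rule linear_compose[OF _ h(1), unfolded o_def]; rule linearI; simp)+
  have pos: "0 \<le> h (v, 0)" "0 \<le> h (0, v)" if "0 \<le> v" for v
  proof -
    \<comment> \<open>Positivity of both components: 0 is a common upper bound of these pairs, so
      \<open>p\<close> is at most 0 there.\<close>
    have "0 \<in> B (- v, 0)" "0 \<in> B (0, - v)" using that by (auto simp: B_def)
    then have "h (- v, 0) \<le> 0" "h (0, - v) \<le> 0"
      using le h(2) by (metis norm_zero order_trans)+
    moreover have "h (- v, 0) = - h (v, 0)" "h (0, - v) = - h (0, v)"
      using linear_neg[OF lin(1)] linear_neg[OF lin(2)] by auto
    ultimately show "0 \<le> h (v, 0)" "0 \<le> h (0, v)" by auto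
  qed
  \<comment> \<open>The sum of the components is \<open>h\<close> on the diagonal, where
    \<open>v\<close> is its own upper bound.\<close>
  have bound: "h (v, 0) + h (0, v) \<le> norm v" if "0 \<le> v" for v
  proof -
    have "h (v, 0) + h (0, v) = h (v, v)" using linear_add[OF h(1), of "(v, 0)" "(0, v)"] by simp
    also have "\<dots> \<le> norm v" using h(2)[of "(v, v)"] le[of v "(v, v)"] that by (simp add: B_def)
    finally show ?thesis .
  qed
  have norm_bound: "\<bar>k v\<bar> \<le> norm v"
    if "linear k" "\<And>v. 0 \<le> v \<Longrightarrow> 0 \<le> k v" "\<And>v. 0 \<le> v \<Longrightarrow> k v \<le> norm v" for k :: "'a \<Rightarrow> real" and v
  proof -
    have "k x \<le> norm x" for x
      using positive_functional_le_lfun[of k 1 x] lfun_le_norm[of "- x"] that by simp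
    from this[of v] this[of "- v"] show ?thesis by (simp add: linear_neg[OF that(1)] abs_le_iff)
  qed
  have bl: "bounded_linear (\<lambda>v. h (v, 0))" "bounded_linear (\<lambda>v. h (0, v))"
  proof -
    have "h (v, 0) \<le> norm v" "h (0, v) \<le> norm v" if "0 \<le> v" for v
      using bound[OF that] pos[OF that] by linarith+
    then have "\<bar>h (v, 0)\<bar> \<le> norm v" "\<bar>h (0, v)\<bar> \<le> norm v" for v
      using norm_bound[OF lin(1) pos(1)] norm_bound[OF lin(2) pos(2)] by blast+
    then show "bounded_linear (\<lambda>v. h (v, 0))" "bounded_linear (\<lambda>v. h (0, v))"
      using lin by (auto intro!: bounded_linear.intro bounded_linear_axioms.intro exI[of _ 1])
  qed
  define f g where "f = Blinfun (\<lambda>v. h (v, 0))" and "g = Blinfun (\<lambda>v. h (0, v))"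
  have f: "f v = h (v, 0)" and g: "g v = h (0, v)" for v
    unfolding f_def g_def by (simp_all add: bounded_linear_Blinfun_apply bl)
  have "norm (f + g) \<le> 1"
  proof (rule norm_blinfun_bound)
    fix v
    have "\<bar>h (v, 0) + h (0, v)\<bar> \<le> norm v"
      by (rule norm_bound) (auto intro!: linear_compose_add lin bound simp: pos)
    then show "norm ((f + g) v) \<le> 1 * norm v" by (simp add: blinfun.add_left f g)
  qed simp
  \<comment> \<open>Norm additivity enters here: the bound on \<open>f + g\<close> limits the total
    weight in \<open>f u + g w\<close>, which is then at most the larger norm.\<close>
  then have fg: "norm f + norm g \<le> 1" using add[of f g] pos by (simp add: f g)
  let ?m = "max (norm u) (norm w)"
  have "p (u, w) = f u + g w"
    using linear_add[OF h(1), of "(u, 0)" "(0, w)"] by (simp add: f g flip: huw)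
  also have "\<dots> \<le> norm f * norm u + norm g * norm w"
    using norm_blinfun[of f u] norm_blinfun[of g w] by simp
  also have "\<dots> \<le> norm f * ?m + norm g * ?m" by (intro add_mono mult_left_mono) auto
  also have "\<dots> = (norm f + norm g) * ?m" by (simp add: algebra_simps)
  also have "\<dots> \<le> ?m" by (intro mult_left_le_one_le fg add_nonneg_nonneg) (auto simp: le_max_iff_disj)
  also have "\<dots> < 1" using u w by (simp add: pos_ball_def)
  finally have "Inf (norm ` B (u, w)) < 1" by (simp add: p_def)
  then obtain k where "k \<in> B (u, w)" "norm k < 1" using cInf_lessD[of "norm ` B (u, w)"] B_ne by blast
  then show "\<exists>k\<in>pos_ball. u \<le> k \<and> w \<le> k" by (auto simp: B_def pos_ball_def)
qed

section \<open>Limits along the positive part of the unit ball\<close>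

text \<open>The filter of tails of the net formed by the ball indexed by itself.\<close>

definition pos_ball_filter :: "'a::{ordered_real_vector, real_normed_vector} filter" where
  "pos_ball_filter = (INF e\<in>pos_ball. principal {k\<in>pos_ball. e \<le> k})"

text \<open>Directedness makes the tails a filter base, so a single tail suffices.\<close>

lemma eventually_pos_ball_filter:
  assumes dir: "directed_set (pos_ball :: 'a::{ordered_real_vector, real_normed_vector} set) (\<le>)"
  shows "eventually P (pos_ball_filter :: 'a filter) \<longleftrightarrow>
    (\<exists>e\<in>pos_ball. \<forall>k\<in>pos_ball. e \<le> k \<longrightarrow> P k)"
proof -
  have ne: "(pos_ball :: 'a set) \<noteq> {}" using dir by (simp add: directed_set_def)
  have "\<exists>k\<in>pos_ball. principal {l\<in>pos_ball. k \<le> l} \<le>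
      inf (principal {l\<in>pos_ball. u \<le> l}) (principal {l\<in>pos_ball. w \<le> l})"
    if uw: "u \<in> pos_ball" "w \<in> pos_ball" for u w :: 'a
  proof -
    obtain k where "k \<in> pos_ball" "u \<le> k" "w \<le> k"
      using dir uw unfolding directed_pos_ball_iff by blast
    then show ?thesis by (intro bexI[of _ k]) (auto intro: order_trans)
  qed
  then show ?thesis
    unfolding pos_ball_filter_def by (subst eventually_INF_base[OF ne]) (auto simp: eventually_principal)
qed

text \<open>Since \<open>0 \<le> e - v \<le> 2 *\<^sub>R e\<close>, both terms of the maximum
  defining the norm are at most 1.\<close>

lemma norm_adjoined_unit_minus_le:
  fixes v e :: "'a::order_smooth_inf_normed"
  assumes e: "norm e \<le> 1" and v: "- e \<le> v" "v \<le> e"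
  shows "norm (adjoined_unit - unit_embed (e - v)) \<le> 1"
proof -
  have "0 \<le> e - v" using v by simp
  then have "lfun (e - v) \<le> 0" by (simp only: lfun_nonpos_iff)
  have "0 \<le> e + e" "0 \<le> e + v"
    using add_left_mono[OF order_trans[OF v], of e] add_left_mono[OF v(1), of e] by simp_all
  then have "0 \<le> 2 *\<^sub>R e" "0 \<le> 2 *\<^sub>R e + - (e - v)" by (simp_all add: scaleR_2)
  then have "lfun (- (e - v)) \<le> norm (2 *\<^sub>R e)" by (rule lfun_le)
  then show ?thesis using \<open>lfun (e - v) \<le> 0\<close> e by (simp add: norm_unitization_eq)
qed

lemma norm_adjoined_unit_minus_pos_ball:
  "e \<in> pos_ball \<Longrightarrow> norm (adjoined_unit - unit_embed e) \<le> 1" for e :: "'a::order_smooth_inf_normed"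
  using norm_adjoined_unit_minus_le[of e 0] by (simp add: pos_ball_def)

lemma norm_blinfun_le_open_ball:
  fixes f :: "'a::real_normed_vector \<Rightarrow>\<^sub>L real"
  assumes le: "\<And>x. norm x < 1 \<Longrightarrow> f x \<le> c"
  shows "norm f \<le> c"
proof -
  have c: "0 \<le> c" using le[of 0] by simp
  have bound: "f x \<le> c * norm x" for x
  proof (rule field_le_epsilon)
    fix d :: real assume d: "0 < d"
    \<comment> \<open>The denominator \<open>c + 1\<close> avoids division by 0 when
      \<open>c = 0\<close>, and \<open>c * t\<close> exceeds \<open>c * norm x\<close> by at most
      \<open>d\<close>.\<close>
    define t where "t = norm x + d / (c + 1)"
    have t: "norm x < t" "0 < t" using c d by (auto simp: t_def intro: add_nonneg_pos)
    then have "f (inverse t *\<^sub>R x) \<le> c" by (intro le) (simp add: field_simps)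
    then have "f x \<le> c * t" using t by (simp add: blinfun.scaleR_right field_simps)
    also have "\<dots> \<le> c * norm x + d" using c d by (simp add: t_def field_simps)
    finally show "f x \<le> c * norm x + d" .
  qed
  show ?thesis
  proof (rule norm_blinfun_bound[OF c])
    show "norm (f x) \<le> c * norm x" for x
      using bound[of x] bound[of "- x"] by (simp add: blinfun.minus_right abs_le_iff)
  qed
qed

lemma eventually_in_pos_ball:
  assumes "directed_set (pos_ball :: 'a::{ordered_real_vector, real_normed_vector} set) (\<le>)"
  shows "\<forall>\<^sub>F e in (pos_ball_filter :: 'a filter). e \<in> pos_ball"
proof -
  have "(pos_ball :: 'a set) \<noteq> {}" using assms by (simp add: directed_set_def)
  then show ?thesis unfolding eventually_pos_ball_filter[OF assms] by blast
qed

lemma pos_ball_filter_neq_bot: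
  assumes "directed_set (pos_ball :: 'a::{ordered_real_vector, real_normed_vector} set) (\<le>)"
  shows "pos_ball_filter \<noteq> (bot :: 'a filter)"
  unfolding trivial_limit_def eventually_pos_ball_filter[OF assms] by auto

text \<open>
  If \<open>f\<close> nearly attains its norm at \<open>x\<close> and \<open>- e \<le> x \<le> e\<close>, then for \<open>k \<ge> e\<close> both
  \<open>x + (k - e)\<close> and \<open>x - (k - e)\<close> lie between \<open>- k\<close> and \<open>k\<close>, so \<open>f\<close> hardly changes from \<open>e\<close> to \<open>k\<close>.
\<close>

lemma blinfun_oscillation:
  fixes f :: "'a::order_smooth_inf_normed \<Rightarrow>\<^sub>L real"
  assumes dir: "directed_set (pos_ball :: 'a set) (\<le>)" and \<epsilon>: "0 < \<epsilon>"
  obtains e where "e \<in> pos_ball" "\<And>k. k \<in> pos_ball \<Longrightarrow> e \<le> k \<Longrightarrow> \<bar>f k - f e\<bar> \<le> \<epsilon>"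
proof -
  have "\<not> norm f \<le> norm f - \<epsilon>" using \<epsilon> by simp
  then obtain x where x: "norm x < 1" "norm f - \<epsilon> < f x"
    using norm_blinfun_le_open_ball[of f "norm f - \<epsilon>"] by (meson not_le)
  obtain e where e: "e \<in> pos_ball" "- e \<le> x" "x \<le> e"
    using directed_pos_ball_dominates[OF dir x(1)] .
  have "\<bar>f k - f e\<bar> \<le> \<epsilon>" if k: "k \<in> pos_ball" "e \<le> k" for k
  proof -
    have bound: "f y \<le> norm f" if "- k \<le> y" "y \<le> k" for y
    proof -
      have "norm y \<le> max (norm (- k)) (norm k)" using that by (rule order_smooth_1)
      also have "\<dots> \<le> 1" using k by (simp add: pos_ball_def)
      finally have "norm f * norm y \<le> norm f" by (simp add: mult_left_le)
      then show ?thesis using norm_blinfun[of f y] by simp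
    qed
    have ek: "0 \<le> k - e" using k by simp
    have "- k \<le> x + (k - e)"
      using add_mono[OF e(2) ek] k(2) by (simp add: order_trans[of "- k" "- e"])
    moreover have "x + (k - e) \<le> k" using e(3) by (simp add: algebra_simps)
    moreover have "- k \<le> x - (k - e)" using add_right_mono[OF e(2), of "e - k"] by simp
    moreover have "x - (k - e) \<le> k"
      using diff_mono[OF e(3) ek] k(2) by (simp add: order_trans[of _ e k])
    ultimately have "f (x + (k - e)) \<le> norm f" "f (x - (k - e)) \<le> norm f" by (blast intro: bound)+
    then show ?thesis
      using x(2) by (simp add: blinfun.add_right blinfun.diff_right abs_le_iff)
  qed
  with e(1) show thesis by (rule that)
qed

text \<open>Small oscillation makes the net of values Cauchy; its limit is constructed as the limit
  superior, the infimum of the eventual upper bounds in \<open>A\<close>.\<close>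

lemma pos_ball_filter_limit:
  fixes f :: "'a::order_smooth_inf_normed \<Rightarrow>\<^sub>L real"
  assumes dir: "directed_set (pos_ball :: 'a set) (\<le>)"
  obtains l where "(f \<longlongrightarrow> l) pos_ball_filter"
proof -
  define A where "A = {b. \<exists>e\<in>pos_ball. \<forall>k\<in>pos_ball. e \<le> k \<longrightarrow> f k \<le> b}"
  \<comment> \<open>By directedness some \<open>k\<close> lies above both \<open>e\<close> and the
    point where the bound \<open>b\<close> takes effect.\<close>
  have lower: "f e - \<epsilon> \<le> b"
    if e: "e \<in> pos_ball" "\<And>k. k \<in> pos_ball \<Longrightarrow> e \<le> k \<Longrightarrow> \<bar>f k - f e\<bar> \<le> \<epsilon>" and b: "b \<in> A" for e \<epsilon> b
  proof -
    obtain e' where e': "e' \<in> pos_ball" "\<And>k. k \<in> pos_ball \<Longrightarrow> e' \<le> k \<Longrightarrow> f k \<le> b"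
      using b by (auto simp: A_def)
    obtain k where "k \<in> pos_ball" "e \<le> k" "e' \<le> k"
      using dir e(1) e'(1) unfolding directed_pos_ball_iff by blast
    then show ?thesis using e(2)[of k] e'(2)[of k] by (simp add: abs_le_iff)
  qed
  obtain e1 where "e1 \<in> pos_ball" "\<And>k. k \<in> pos_ball \<Longrightarrow> e1 \<le> k \<Longrightarrow> \<bar>f k - f e1\<bar> \<le> 1"
    using blinfun_oscillation[OF dir, of 1 f] by auto
  then have bdd: "bdd_below A" using lower[of e1 1] by (intro bdd_belowI) blast
  have "(f \<longlongrightarrow> Inf A) pos_ball_filter"
  proof (rule tendstoI)
    fix \<epsilon> :: real assume "0 < \<epsilon>"
    then obtain e where e: "e \<in> pos_ball" "\<And>k. k \<in> pos_ball \<Longrightarrow> e \<le> k \<Longrightarrow> \<bar>f k - f e\<bar> \<le> \<epsilon> / 3"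
      using blinfun_oscillation[OF dir, of "\<epsilon> / 3" f] by auto
    have "f k \<le> f e + \<epsilon> / 3" if "k \<in> pos_ball" "e \<le> k" for k
      using e(2)[OF that] by linarith
    then have "f e + \<epsilon> / 3 \<in> A" unfolding A_def using e(1) by blast
    then have "Inf A \<le> f e + \<epsilon> / 3" "f e - \<epsilon> / 3 \<le> Inf A"
      using bdd lower[OF e] by (auto intro!: cInf_lower cInf_greatest)
    then have "dist (f k) (Inf A) < \<epsilon>" if "k \<in> pos_ball" "e \<le> k" for k
      using e(2)[OF that] \<open>0 < \<epsilon>\<close> unfolding dist_real_def by linarith
    then show "\<forall>\<^sub>F k in pos_ball_filter. dist (f k) (Inf A) < \<epsilon>"
      unfolding eventually_pos_ball_filter[OF dir] using e(1) by blast
  qed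
  then show thesis by (rule that)
qed

text \<open>The bounds \<open>- 1 < z < 1\<close> relative to the order unit survive replacing that
  unit by a late \<open>e\<close>. The norm condition yields witnesses \<open>u\<close> and
  \<open>w\<close> for the two values of \<open>lfun\<close>; rescaled into the ball, they have a
  common upper bound from which the tail starts.\<close>

lemma eventually_dominates:
  fixes z :: "'a::order_smooth_inf_normed unitization"
  assumes dir: "directed_set (pos_ball :: 'a set) (\<le>)" and z: "norm z < 1"
  shows "\<forall>\<^sub>F e in pos_ball_filter. - e \<le> vec_part z + scalar_part z *\<^sub>R e \<and>
    vec_part z + scalar_part z *\<^sub>R e \<le> e"
proof -
  let ?v = "vec_part z" and ?a = "scalar_part z"
  have "lfun ?v < 1 + ?a" "lfun (- ?v) < 1 - ?a" using z by (simp_all add: norm_unitization_eq)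
  then obtain u w where u: "0 \<le> u" "0 \<le> u + ?v" "norm u < 1 + ?a"
    and w: "0 \<le> w" "0 \<le> w + - ?v" "norm w < 1 - ?a" by (meson lfun_lessE)
  \<comment> \<open>Both rescaling factors are positive because they exceed norms.\<close>
  have a: "0 < 1 + ?a" "0 < 1 - ?a"
    using u(3) w(3) norm_ge_zero[of u] norm_ge_zero[of w] by linarith+
  have "inverse (1 + ?a) *\<^sub>R u \<in> pos_ball" "inverse (1 - ?a) *\<^sub>R w \<in> pos_ball"
    using u w a by (auto simp: pos_ball_def field_simps intro!: scaleR_nonneg_nonneg)
  then obtain e where e: "e \<in> pos_ball" "inverse (1 + ?a) *\<^sub>R u \<le> e" "inverse (1 - ?a) *\<^sub>R w \<le> e"
    using dir unfolding directed_pos_ball_iff by blast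
  have "- k \<le> ?v + ?a *\<^sub>R k \<and> ?v + ?a *\<^sub>R k \<le> k" if k: "e \<le> k" for k
  proof -
    have scale: "y \<le> t *\<^sub>R k" if "inverse t *\<^sub>R y \<le> e" "0 < t" for t y
    proof -
      have "t *\<^sub>R (inverse t *\<^sub>R y) \<le> t *\<^sub>R k" using that k by (intro scaleR_left_mono) auto
      moreover have "t *\<^sub>R (inverse t *\<^sub>R y) = y" using that by simp
      ultimately show ?thesis by (simp only:)
    qed
    have "0 \<le> (1 + ?a) *\<^sub>R k + ?v"
      using add_right_mono[OF scale[OF e(2) a(1)], of ?v] u(2) by (rule order_trans[rotated])
    moreover have "0 \<le> (1 - ?a) *\<^sub>R k + - ?v"
      using add_right_mono[OF scale[OF e(3) a(2)], of "- ?v"] w(2) by (rule order_trans[rotated])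
    moreover have "(1 + ?a) *\<^sub>R k + ?v = (?v + ?a *\<^sub>R k) - (- k)"
      "(1 - ?a) *\<^sub>R k + - ?v = k - (?v + ?a *\<^sub>R k)" by (simp_all add: algebra_simps)
    ultimately show ?thesis by (simp only: diff_ge_0_iff_ge)
  qed
  then show ?thesis unfolding eventually_pos_ball_filter[OF dir] using e(1) by blast
qed

section \<open>The complement of the annihilator\<close>

lemma subspace_annihilator: "subspace (annihilator W)"
  by (auto simp: subspace_def annihilator_def blinfun.add_left blinfun.scaleR_left)

lemma closed_annihilator: "closed (annihilator W)"
proof -
  have "annihilator W = (\<Inter>w\<in>W. {f. blinfun_apply f w = 0})" by (auto simp: annihilator_def)
  moreover have "closed {f. blinfun_apply f w = 0}" for w :: 'a
    by (intro closed_Collect_eq continuous_intros)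
  ultimately show ?thesis by auto
qed

lemma range_unit_embed: "range unit_embed = {x :: 'a::real_vector unitization. scalar_part x = 0}"
proof -
  have "x = unit_embed (vec_part x)" if "scalar_part x = 0" for x :: "'a unitization"
    using that by (intro unitization.expand) simp
  then show ?thesis by auto
qed

lemma annihilator_range_unit_embed:
  fixes f :: "'a::order_smooth_inf_normed unitization \<Rightarrow>\<^sub>L real"
  assumes "f \<in> annihilator (range unit_embed)"
  shows "f z = f adjoined_unit * scalar_part z"
proof -
  have "z = unit_embed (vec_part z) + scalar_part z *\<^sub>R adjoined_unit"
    by (rule unitization.expand) simp
  then have "f z = f (unit_embed (vec_part z) + scalar_part z *\<^sub>R adjoined_unit)" by (rule arg_cong)
  then show ?thesis
    using assms by (simp add: annihilator_def blinfun.add_right blinfun.scaleR_right)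
qed

section \<open>From directedness to the M-ideal property\<close>

lemma M_ideal_if_directed:
  assumes dir: "directed_set (pos_ball :: 'a::{order_smooth_inf_normed, banach} set) (\<le>)"
  shows "M_ideal (range (unit_embed :: 'a \<Rightarrow> 'a unitization))"
proof -
  let ?X = "annihilator (range (unit_embed :: 'a \<Rightarrow> 'a unitization))"
  let ?F = "pos_ball_filter :: 'a filter"
  define c where "c e = adjoined_unit - unit_embed e" for e :: 'a
  have c_norm: "norm (c e) \<le> 1" if "e \<in> pos_ball" for e
    unfolding c_def using that by (rule norm_adjoined_unit_minus_pos_ball)
  \<comment> \<open>On \<open>c e\<close> an element of the annihilator is constant, so a vanishing
    limit singles out functionals without an annihilator component.\<close>
  define Y where "Y = {g :: 'a unitization \<Rightarrow>\<^sub>L real. ((\<lambda>e. g (c e)) \<longlongrightarrow> 0) ?F}"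
  have Xc: "x (c e) = x adjoined_unit" if "x \<in> ?X" for x e
    using annihilator_range_unit_embed[OF that, of "c e"] by (simp add: c_def)
  have subY: "subspace Y"
    unfolding subspace_def Y_def
    by (auto simp: blinfun.add_left blinfun.scaleR_left intro: tendsto_add_zero tendsto_mult_right_zero)
  have "closure Y \<subseteq> Y"
  proof
    fix g assume g: "g \<in> closure Y"
    have "((\<lambda>e. g (c e)) \<longlongrightarrow> 0) ?F"
    proof (rule tendstoI)
      fix \<epsilon> :: real assume "0 < \<epsilon>"
      then obtain y where y: "y \<in> Y" "dist y g < \<epsilon> / 2"
        using g closure_approachable[of g Y] half_gt_zero by blast
      \<comment> \<open>The vectors \<open>c e\<close> are uniformly bounded, so norm approximation
        of \<open>g\<close> controls its values along the whole net.\<close>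
      have near: "\<bar>g (c e) - y (c e)\<bar> < \<epsilon> / 2" if "e \<in> pos_ball" for e
      proof -
        have "norm ((g - y) (c e)) \<le> norm (g - y) * norm (c e)" by (rule norm_blinfun)
        also have "\<dots> \<le> norm (g - y)" using c_norm[OF that] by (simp add: mult_left_le)
        also have "\<dots> < \<epsilon> / 2" using y(2) by (metis dist_commute dist_norm)
        finally show ?thesis by (simp add: blinfun.diff_left)
      qed
      have "\<forall>\<^sub>F e in ?F. e \<in> pos_ball"
        by (rule eventually_in_pos_ball[OF dir])
      moreover have "\<forall>\<^sub>F e in ?F. dist (y (c e)) 0 < \<epsilon> / 2"
        using y(1) \<open>0 < \<epsilon>\<close> unfolding Y_def by (intro tendstoD) auto
      ultimately show "\<forall>\<^sub>F e in ?F. dist (g (c e)) 0 < \<epsilon>"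
      proof eventually_elim
        case (elim e)
        then show ?case using near[of e] unfolding dist_real_def by linarith
      qed
    qed
    then show "g \<in> Y" by (simp add: Y_def)
  qed
  then have clY: "closed Y" by (simp add: closure_subset_eq)
  have "x = 0" if x: "x \<in> ?X" "x \<in> Y" for x
  proof (rule blinfun_eqI)
    fix z
    have "((\<lambda>e. x adjoined_unit) \<longlongrightarrow> 0) ?F" using x(2) by (simp add: Y_def Xc[OF x(1)])
    then have "x adjoined_unit = 0"
      using tendsto_unique[OF pos_ball_filter_neq_bot[OF dir] tendsto_const] by blast
    then show "x z = blinfun_apply 0 z" using annihilator_range_unit_embed[OF x(1), of z] by simp
  qed
  moreover have "0 \<in> ?X" "0 \<in> Y" using subspace_annihilator subY by (auto intro: subspace_0)
  ultimately have int: "?X \<inter> Y = {0}" by blast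
  have sum: "\<exists>x\<in>?X. \<exists>y\<in>Y. g = x + y" for g
  proof -
    have bl: "bounded_linear (\<lambda>v. g (unit_embed v))"
      by (rule bounded_linear_compose[OF blinfun.bounded_linear_right bounded_linear_unit_embed])
    obtain l where l: "((\<lambda>v. g (unit_embed v)) \<longlongrightarrow> l) ?F"
      using pos_ball_filter_limit[OF dir, of "Blinfun (\<lambda>v. g (unit_embed v))"]
      by (auto simp: bounded_linear_Blinfun_apply[OF bl])
    \<comment> \<open>Along the net \<open>g (c e)\<close> tends to
      \<open>g adjoined_unit - l\<close>; this multiple of the scalar part removes exactly that
      limit.\<close>
    define x where "x = (g adjoined_unit - l) *\<^sub>R Blinfun (scalar_part :: 'a unitization \<Rightarrow> real)"
    have x: "x z = (g adjoined_unit - l) * scalar_part z" for z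
      by (simp add: x_def blinfun.scaleR_left bounded_linear_Blinfun_apply[OF bounded_linear_scalar_part])
    have "x \<in> ?X" by (auto simp: annihilator_def x)
    moreover have "(\<lambda>e. (g - x) (c e)) = (\<lambda>e. l - g (unit_embed e))"
      by (simp add: blinfun.diff_left blinfun.diff_right x c_def)
    then have "g - x \<in> Y" using tendsto_diff[OF tendsto_const l, of l] by (simp add: Y_def)
    ultimately show ?thesis by (intro bexI[of _ x] bexI[of _ "g - x"]) simp_all
  qed
  have L: "norm (x + y) = norm x + norm y" if x: "x \<in> ?X" and y: "y \<in> Y" for x y
  proof (rule antisym[OF norm_triangle_ineq])
    define d where "d = x adjoined_unit"
    have xd: "x z = d * scalar_part z" for z
      unfolding d_def by (rule annihilator_range_unit_embed[OF x])
    have "norm (x z) \<le> \<bar>d\<bar> * norm z" for z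
      using abs_scalar_part_le[of z] by (simp add: xd abs_mult mult_left_mono)
    then have norm_x: "norm x \<le> \<bar>d\<bar>" by (intro norm_blinfun_bound) auto
    have key: "y z + s * d \<le> norm (x + y)" if z: "norm z < 1" and s: "s = 1 \<or> s = - 1" for z s
    proof -
      \<comment> \<open>Correcting \<open>z\<close> by a multiple of \<open>c e\<close> moves its
        scalar part to \<open>s\<close>, so \<open>x\<close> takes the value \<open>s * d\<close>,
        while \<open>y (t e)\<close> still tends to \<open>y z\<close>. With \<open>t e\<close>
        eventually in the closed unit ball, both norms are seen at once.\<close>
      define t where "t e = z + (s - scalar_part z) *\<^sub>R c e" for e
      have t_norm: "norm (t e) \<le> 1"
        if e: "norm e \<le> 1" "- e \<le> vec_part z + scalar_part z *\<^sub>R e"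
          "vec_part z + scalar_part z *\<^sub>R e \<le> e" for e
      proof -
        let ?v = "vec_part z + scalar_part z *\<^sub>R e"
        from s show ?thesis
        proof
          assume "s = 1"
          \<comment> \<open>This form, and its negative when \<open>s = - 1\<close>, is the one
            whose norm is bounded through \<open>- e \<le> ?v \<le> e\<close>.\<close>
          then have "t e = adjoined_unit - unit_embed (e - ?v)"
            by (intro unitization.expand) (simp add: t_def c_def algebra_simps)
          then show ?thesis using norm_adjoined_unit_minus_le[OF e] by simp
        next
          assume "s = - 1"
          then have "t e = - (adjoined_unit - unit_embed (e - (- ?v)))"
            by (intro unitization.expand) (simp add: t_def c_def algebra_simps)
          moreover have "- e \<le> - ?v" "- ?v \<le> e" using e(2,3) by (simp_all only: neg_le_iff_le minus_le_iff)
          ultimately show ?thesis using norm_adjoined_unit_minus_le[OF e(1)] by (simp only: norm_minus_cancel)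
        qed
      qed
      have "y (t e) = y z + (s - scalar_part z) * y (c e)" for e
        by (simp add: t_def blinfun.add_right blinfun.scaleR_right)
      moreover have "scalar_part (t e) = s" for e by (simp add: t_def c_def)
      ultimately have xyt: "(x + y) (t e) = y z + (s - scalar_part z) * y (c e) + s * d" for e
        by (simp add: blinfun.add_left xd)
      have "((\<lambda>e. y z + (s - scalar_part z) * y (c e) + s * d) \<longlongrightarrow> y z + (s - scalar_part z) * 0 + s * d) ?F"
        using y unfolding Y_def by (intro tendsto_intros) auto
      moreover have "\<forall>\<^sub>F e in ?F. y z + (s - scalar_part z) * y (c e) + s * d \<le> norm (x + y)"
      proof -
        have "\<forall>\<^sub>F e in ?F. norm e \<le> 1"
          using eventually_in_pos_ball[OF dir] by eventually_elim (simp add: pos_ball_def)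
        with eventually_dominates[OF dir z] show ?thesis
        proof eventually_elim
          case (elim e)
          then have "norm (x + y) * norm (t e) \<le> norm (x + y)" using t_norm by (simp add: mult_left_le)
          then show ?case using norm_blinfun[of "x + y" "t e"] unfolding xyt by simp
        qed
      qed
      ultimately show ?thesis
        using tendsto_upperbound pos_ball_filter_neq_bot[OF dir] by fastforce
    qed
    \<comment> \<open>The two signs of \<open>s\<close> together replace \<open>s * d\<close> by
      \<open>\<bar>d\<bar>\<close>, which bounds \<open>norm x\<close>.\<close>
    have "y z \<le> norm (x + y) - \<bar>d\<bar>" if "norm z < 1" for z
      using key[OF that, of 1] key[OF that, of "- 1"] by simp
    then have "norm y \<le> norm (x + y) - \<bar>d\<bar>" by (rule norm_blinfun_le_open_ball)
    with norm_x show "norm x + norm y \<le> norm (x + y)" by simp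
  qed
  have "L_summand ?X"
    unfolding L_summand_def using subspace_annihilator closed_annihilator subY clY int sum L by blast
  moreover have "subspace (range (unit_embed :: 'a \<Rightarrow> 'a unitization))"
    by (simp add: range_unit_embed subspace_def)
  moreover have "closed (range (unit_embed :: 'a \<Rightarrow> 'a unitization))"
    unfolding range_unit_embed
    by (intro closed_Collect_eq continuous_on_const
        linear_continuous_on bounded_linear_scalar_part)
  ultimately show ?thesis by (simp add: M_ideal_def)
qed

theorem theorem4p7:
  shows "M_ideal (range (unit_embed :: 'a::{order_smooth_inf_normed, banach} \<Rightarrow> 'a unitization))
    \<longleftrightarrow> approx_order_unit_space TYPE('a)"
  unfolding approx_order_unit_space_iff_directed
  using M_ideal_if_directed directed_pos_ball_if_norm_add[OF M_ideal_norm_add] by blast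

end
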